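(* Let $\nu>0$, let $k\in\{0,1,2,\dots\}$ be such that $\nu\in(k/2,(k+1)/2]$, and let $p\ge1$. Suppose that $f=h+\overline g\in\mathcal{B}_H(\nu)$, where $h(z)=\sum_{n=0}^\infty a_nz^n$ and $g(z)=\sum_{n=1}^\infty b_nz^n$, and $\|f\|_{\mathcal{B}_H(\nu)}\le1$. Then $$|a_0|+\sum_{n=1}^\infty(|a_n|^p+|b_n|^p)^{1/p}r^n\le1$$ for $|z|=r\le\max\{r_1(\nu,p),r_2(k,p)\}$. Here $r_1(\nu,p)$ is the unique solution in $(0,1)$ to the equation $$6(1-r^2)^{2\nu}-M_p\pi^2r^2=0$$ and $r_2(k,p)$ is the unique solution in $(0,1)$ to the equation $$M_p\,rF_k(r)-1+r=0,$$ where $M_p=\max\{2^{(2/p)-1},1\}$ and $$F_0(r)=\sum_{n=1}^\infty\frac{r^n}{n^2},\qquad F_1(r)=\log\frac1{1-r},\qquad F_k(r)=\frac1k\log\frac1{1-r}+\frac1k\sum_{n=1}^{k-1}\frac1n\left(\frac1{(1-r)^n}-1\right)\ \text{ for }k\ge2.$$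
   Context: $\mathbb{D}$ is the open unit disk in $\mathbb{C}$. A harmonic mapping in $\mathbb{D}$ is a complex-valued $f$ with $f_{z\overline z}=0$; its canonical decomposition is $f=h+\overline g$ with $h,g$ analytic in $\mathbb{D}$, $g(0)=0$. For $\nu>0$, $\mathcal{B}_H(\nu)$ is the space of harmonic mappings $f=h+\overline g$ in $\mathbb{D}$ with $\beta_\nu(f)=\sup_{z\in\mathbb{D}}(1-|z|^2)^\nu(|h'(z)|+|g'(z)|)<\infty$, normed by $\|f\|_{\mathcal{B}_H(\nu)}=|f(0)|+\beta_\nu(f)$. *)

theory Defs
  imports "HOL-Complex_Analysis.Complex_Analysis"
begin

abbreviation unit_disk :: "complex set" where
  "unit_disk \<equiv> ball 0 1"

text \<open>The Wirtinger derivatives; \<^const>\<open>frechet_derivative\<close> is the real derivative here.\<close>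

definition wirtinger_z :: "(complex \<Rightarrow> complex) \<Rightarrow> complex \<Rightarrow> complex" where
  "wirtinger_z f z =
     (frechet_derivative f (at z) 1 - \<i> * frechet_derivative f (at z) \<i>) / 2"

definition wirtinger_zbar :: "(complex \<Rightarrow> complex) \<Rightarrow> complex \<Rightarrow> complex" where
  "wirtinger_zbar f z =
     (frechet_derivative f (at z) 1 + \<i> * frechet_derivative f (at z) \<i>) / 2"

text \<open>
  Only the differentiability needed to form the mixed derivative is demanded: a
  real-differentiable function with vanishing \<open>zbar\<close>-derivative is holomorphic, so
  \<open>wirtinger_z f\<close> is holomorphic and \<open>f\<close> is automatically smooth.
\<close>

definition harmonic_mapping :: "(complex \<Rightarrow> complex) \<Rightarrow> bool" where
  "harmonic_mapping f \<longleftrightarrow>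
     (\<forall>z\<in>unit_disk. f differentiable (at z) \<and> wirtinger_z f differentiable (at z) \<and>
        wirtinger_zbar (wirtinger_z f) z = 0)"

definition canonical_decomposition ::
    "(complex \<Rightarrow> complex) \<Rightarrow> (complex \<Rightarrow> complex) \<Rightarrow> (complex \<Rightarrow> complex) \<Rightarrow> bool" where
  "canonical_decomposition f h g \<longleftrightarrow>
     h holomorphic_on unit_disk \<and> g holomorphic_on unit_disk \<and> g 0 = 0 \<and>
     (\<forall>z\<in>unit_disk. f z = h z + cnj (g z))"

definition bloch_weight ::
    "real \<Rightarrow> (complex \<Rightarrow> complex) \<Rightarrow> (complex \<Rightarrow> complex) \<Rightarrow> complex \<Rightarrow> real" where
  "bloch_weight \<nu> h g z =
     (1 - (norm z)\<^sup>2) powr \<nu> * (norm (deriv h z) + norm (deriv g z))"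

definition harmonic_Bloch :: "real \<Rightarrow> (complex \<Rightarrow> complex) set" where
  "harmonic_Bloch \<nu> = {f. harmonic_mapping f \<and>
     (\<exists>h g. canonical_decomposition f h g \<and> bdd_above (bloch_weight \<nu> h g ` unit_disk))}"

text \<open>
  The decomposition is unique on the disk but not as a pair of functions on the whole
  plane, hence the choice; see \<open>bloch_seminorm_eq\<close> below.  The supremum is the intended one
  for \<open>f \<in> harmonic_Bloch \<nu>\<close>, where the set is bounded above.
\<close>

definition bloch_seminorm :: "real \<Rightarrow> (complex \<Rightarrow> complex) \<Rightarrow> real" where
  "bloch_seminorm \<nu> f =
     (let (h, g) = (SOME (h, g). canonical_decomposition f h g)
      in SUP z\<in>unit_disk. bloch_weight \<nu> h g z)"

definition bloch_norm :: "real \<Rightarrow> (complex \<Rightarrow> complex) \<Rightarrow> real" where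
  "bloch_norm \<nu> f = norm (f 0) + bloch_seminorm \<nu> f"

definition M_const :: "real \<Rightarrow> real" where
  "M_const p = max (2 powr (2 / p - 1)) 1"

definition F_fun :: "nat \<Rightarrow> real \<Rightarrow> real" where
  "F_fun k r =
     (if k = 0 then (\<Sum>n. r ^ Suc n / (real (Suc n))\<^sup>2)
      else if k = 1 then ln (1 / (1 - r))
      else 1 / real k * ln (1 / (1 - r)) +
           1 / real k * (\<Sum>n = 1..k - 1. 1 / real n * (1 / (1 - r) ^ n - 1)))"

definition is_r1 :: "real \<Rightarrow> real \<Rightarrow> real \<Rightarrow> bool" where
  "is_r1 \<nu> p r \<longleftrightarrow> r \<in> {0<..<1} \<and>
     6 * (1 - r\<^sup>2) powr (2 * \<nu>) - M_const p * pi\<^sup>2 * r\<^sup>2 = 0"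

definition is_r2 :: "nat \<Rightarrow> real \<Rightarrow> real \<Rightarrow> bool" where
  "is_r2 k p r \<longleftrightarrow> r \<in> {0<..<1} \<and> M_const p * r * F_fun k r - 1 + r = 0"

definition r1 :: "real \<Rightarrow> real \<Rightarrow> real" where
  "r1 \<nu> p = (THE r. is_r1 \<nu> p r)"

definition r2 :: "nat \<Rightarrow> real \<Rightarrow> real" where
  "r2 k p = (THE r. is_r2 k p r)"

lemma canonical_decomposition_has_derivative:
  assumes "canonical_decomposition f h g" "z \<in> unit_disk"
  shows "(f has_derivative (\<lambda>w. deriv h z * w + cnj (deriv g z * w))) (at z)"
proof -
  have "(h has_field_derivative deriv h z) (at z)" "(g has_field_derivative deriv g z) (at z)"
    using assms unfolding canonical_decomposition_def
    by (auto intro!: holomorphic_derivI[where S = unit_disk])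
  then have "((\<lambda>w. h w + cnj (g w)) has_derivative
      (\<lambda>w. deriv h z * w + cnj (deriv g z * w))) (at z)"
    unfolding has_field_derivative_def
    by (intro has_derivative_add has_derivative_cnj)
  then show ?thesis
    by (rule has_derivative_transform_within_open[where s = unit_disk])
      (use assms in \<open>auto simp: canonical_decomposition_def\<close>)
qed

lemma canonical_decomposition_wirtinger:
  assumes "canonical_decomposition f h g" "z \<in> unit_disk"
  shows "wirtinger_z f z = deriv h z" "wirtinger_zbar f z = cnj (deriv g z)"
proof -
  have "frechet_derivative f (at z) = (\<lambda>w. deriv h z * w + cnj (deriv g z * w))"
    by (rule frechet_derivative_at[symmetric, OF canonical_decomposition_has_derivative[OF assms]])
  then show "wirtinger_z f z = deriv h z" "wirtinger_zbar f z = cnj (deriv g z)"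
    by (simp_all add: wirtinger_z_def wirtinger_zbar_def algebra_simps)
qed

lemma canonical_decomposition_imp_harmonic_mapping:
  assumes "canonical_decomposition f h g"
  shows "harmonic_mapping f"
  unfolding harmonic_mapping_def
proof (intro ballI conjI)
  fix z :: complex assume z: "z \<in> unit_disk"
  show "f differentiable (at z)"
    using canonical_decomposition_has_derivative[OF assms z] differentiableI by blast
  have "deriv h holomorphic_on unit_disk"
    using assms by (auto simp: canonical_decomposition_def intro!: holomorphic_deriv)
  then have "(deriv h has_derivative (\<lambda>w. deriv (deriv h) z * w)) (at z)"
    using z holomorphic_derivI[of "deriv h" unit_disk z] by (simp add: has_field_derivative_def)
  then have D: "(wirtinger_z f has_derivative (\<lambda>w. deriv (deriv h) z * w)) (at z)"
    by (rule has_derivative_transform_within_open[where s = unit_disk])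
      (use z canonical_decomposition_wirtinger[OF assms] in auto)
  then show "wirtinger_z f differentiable (at z)"
    using differentiableI by blast
  have "frechet_derivative (wirtinger_z f) (at z) = (\<lambda>w. deriv (deriv h) z * w)"
    by (rule frechet_derivative_at[symmetric, OF D])
  then show "wirtinger_zbar (wirtinger_z f) z = 0"
    by (simp add: wirtinger_zbar_def algebra_simps)
qed

lemma bloch_seminorm_eq:
  assumes "canonical_decomposition f h g"
  shows "bloch_seminorm \<nu> f = (SUP z\<in>unit_disk. bloch_weight \<nu> h g z)"
proof -
  obtain h' g' where hg': "(SOME (h, g). canonical_decomposition f h g) = (h', g')"
    by fastforce
  have "case (SOME (h, g). canonical_decomposition f h g) of
      (h, g) \<Rightarrow> canonical_decomposition f h g"
    by (rule someI[of "\<lambda>(h, g). canonical_decomposition f h g" "(h, g)"]) (use assms in simp)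
  then have dec: "canonical_decomposition f h' g'"
    by (simp add: hg')
  have "bloch_weight \<nu> h' g' z = bloch_weight \<nu> h g z" if "z \<in> unit_disk" for z
  proof -
    have "deriv h' z = deriv h z" "cnj (deriv g' z) = cnj (deriv g z)"
      using canonical_decomposition_wirtinger[OF dec that]
        canonical_decomposition_wirtinger[OF assms that] by (auto simp del: complex_cnj_cancel_iff)
    then show ?thesis
      by (simp add: bloch_weight_def)
  qed
  then show ?thesis
    by (simp add: bloch_seminorm_def hg')
qed

end

theory Submission
  imports Defs
begin

text \<open>
  Write \<open>c\<^sub>n = \<bar>a\<^sub>n\<bar>\<^sup>2 + \<bar>b\<^sub>n\<bar>\<^sup>2\<close> and \<open>K = 1 - \<bar>a\<^sub>0\<bar>\<close>, an upper bound for the Bloch seminorm.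
  Parseval on the circle of radius \<open>r\<close> gives
  \<open>\<Sum> n\<^sup>2 c\<^sub>n r\<^bsup>2n-2\<^esup> \<le> K\<^sup>2 (1 - r\<^sup>2)\<^bsup>-2\<nu>\<^esup>\<close>, and the \<open>p\<close>-norm of \<open>(a\<^sub>n, b\<^sub>n)\<close> is at most
  \<open>\<surd>(M\<^sub>p c\<^sub>n)\<close>.  For \<open>r \<le> r\<^sub>1\<close> apply Cauchy-Schwarz against the weights \<open>r / n\<close>, whose squares
  sum to \<open>r\<^sup>2 \<pi>\<^sup>2 / 6\<close>.  For \<open>r \<le> r\<^sub>2\<close> put \<open>x = r\<^sup>2\<close>, replace \<open>2\<nu>\<close> by \<open>k + 1\<close> and integrate twice to
  obtain \<open>\<Sum> c\<^sub>n x\<^sup>n \<le> K\<^sup>2 F\<^sub>k(x)\<close> for every \<open>x\<close> in \<open>(0, 1)\<close>; then take \<open>x = r\<close> and apply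
  Cauchy-Schwarz against the geometric series.
\<close>

section \<open>Parseval's inequality on a circle, by finite averages\<close>

text \<open>Discrete orthogonality: for distinct exponents \<open>n\<close>, \<open>l\<close> below
  \<open>m\<close>, the number \<open>w n * cnj (w l)\<close> is an \<open>m\<close>-th root of
  unity other than 1, so its powers sum to zero over a full period. Exponents below \<open>m\<close>
  cannot collide modulo \<open>m\<close>.\<close>

lemma parseval_roots_of_unity:
  fixes \<alpha> :: "nat \<Rightarrow> complex" and m :: nat
  defines "w \<equiv> \<lambda>j. cis (2 * pi * real j / real m)"
  shows "(\<Sum>j<m. (norm (\<Sum>n<m. \<alpha> n * w j ^ n))\<^sup>2) = real m * (\<Sum>n<m. (norm (\<alpha> n))\<^sup>2)"
proof -
  have orth: "(\<Sum>j<m. w j ^ n * cnj (w j ^ l)) = (if n = l then of_nat m else 0)"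
    if "n < m" "l < m" for n l
  proof -
    have m: "m > 0"
      using that by simp
    define \<zeta> where "\<zeta> = w n * cnj (w l)"
    \<comment> \<open>Exchanging index and exponent turns the sum over \<open>j\<close> into a
      geometric sum with the fixed ratio \<open>\<zeta>\<close>.\<close>
    have pow: "w j ^ n = w n ^ j" for j n
      by (simp add: w_def Complex.DeMoivre mult_ac)
    have wm: "w n ^ m = 1" for n
      using pow[of n m] m by (simp add: w_def)
    have "w j ^ n * cnj (w j ^ l) = \<zeta> ^ j" for j
      using pow[of j n] pow[of j l] by (simp add: \<zeta>_def power_mult_distrib flip: complex_cnj_power)
    then have sum_eq: "(\<Sum>j<m. w j ^ n * cnj (w j ^ l)) = (\<Sum>j<m. \<zeta> ^ j)"
      by simp
    have unit: "w l * cnj (w l) = 1"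
      by (simp add: w_def cis_cnj cis_mult)
    show ?thesis
    proof (cases "n = l")
      case True
      then show ?thesis
        unfolding sum_eq by (simp add: \<zeta>_def unit)
    next
      case False
      have "inj_on w {..<m}"
        using Complex.bij_betw_roots_unity[OF m] by (simp add: w_def bij_betw_def)
      then have "w n \<noteq> w l"
        using that False by (auto dest: inj_onD)
      then have "\<zeta> \<noteq> 1"
        using unit by (metis \<zeta>_def mult.commute mult.left_commute mult_1_right)
      moreover have "\<zeta> ^ m = 1"
        by (simp add: \<zeta>_def power_mult_distrib wm flip: complex_cnj_power)
      ultimately show ?thesis
        unfolding sum_eq using False by (simp add: geometric_sum)
    qed
  qed
  have "complex_of_real (\<Sum>j<m. (norm (\<Sum>n<m. \<alpha> n * w j ^ n))\<^sup>2) =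
      (\<Sum>j<m. \<Sum>n<m. \<Sum>l<m. \<alpha> n * cnj (\<alpha> l) * (w j ^ n * cnj (w j ^ l)))"
    by (simp add: complex_norm_square sum_product mult_ac del: of_real_power)
  also have "\<dots> = (\<Sum>n<m. \<Sum>l<m. \<Sum>j<m. \<alpha> n * cnj (\<alpha> l) * (w j ^ n * cnj (w j ^ l)))"
    by (subst sum.swap, rule sum.cong[OF refl], rule sum.swap)
  also have "\<dots> = (\<Sum>n<m. \<Sum>l<m. \<alpha> n * cnj (\<alpha> l) * (if n = l then of_nat m else 0))"
    using orth by (simp add: sum_distrib_left[symmetric] del: complex_cnj_power)
  also have "\<dots> = (\<Sum>n<m. \<alpha> n * cnj (\<alpha> n) * of_nat m)"
    by (simp add: if_distrib cong: if_cong)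
  also have "\<dots> = complex_of_real (real m * (\<Sum>n<m. (norm (\<alpha> n))\<^sup>2))"
    by (simp only: of_real_mult of_real_of_nat_eq of_real_sum complex_norm_square
        sum_distrib_left mult_ac)
  finally show ?thesis
    by (simp only: of_real_eq_iff)
qed

text \<open>
  Averaging the partial sums of degree below \<open>m\<close> over the \<open>m\<close>-th roots of unity gives
  Parseval's identity without integrals; the tails vanish uniformly on the circle.
\<close>

lemma sum_coeff_squares_le:
  fixes \<alpha> \<beta> :: "nat \<Rightarrow> complex" and \<phi> \<psi> :: "complex \<Rightarrow> complex"
  assumes \<phi>: "\<And>z. norm z < 1 \<Longrightarrow> (\<lambda>n. \<alpha> n * z ^ n) sums \<phi> z"
    and \<psi>: "\<And>z. norm z < 1 \<Longrightarrow> (\<lambda>n. \<beta> n * z ^ n) sums \<psi> z"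
    and r: "0 \<le> r" "r < 1"
    and K: "\<And>z. norm z = r \<Longrightarrow> norm (\<phi> z) + norm (\<psi> z) \<le> K"
  shows "(\<Sum>n<N. ((norm (\<alpha> n))\<^sup>2 + (norm (\<beta> n))\<^sup>2) * r ^ (2 * n)) \<le> K\<^sup>2"
proof -
  have abs_summable: "summable (\<lambda>n. norm (\<gamma> n) * r ^ n)"
    if "\<And>z. norm z < 1 \<Longrightarrow> (\<lambda>n. \<gamma> n * z ^ n) sums u z"
    for \<gamma> :: "nat \<Rightarrow> complex" and u
  proof -
    \<comment> \<open>A radius strictly between \<open>r\<close> and 1: convergence at
      \<open>s\<close> forces absolute convergence at \<open>r\<close>.\<close>
    define s where "s = (r + 1) / 2"
    have s: "r < s" "s < 1" "0 \<le> s"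
      using r by (auto simp: s_def)
    have "summable (\<lambda>n. \<gamma> n * of_real s ^ n)"
      using that[of "of_real s"] s by (auto intro: sums_summable)
    then have "summable (\<lambda>n. norm (\<gamma> n * of_real r ^ n))"
      by (rule powser_insidea) (use s r in auto)
    then show ?thesis
      using r by (simp add: norm_mult norm_power)
  qed
  define tail where "tail \<gamma> m = (\<Sum>n. norm (\<gamma> (n + m)) * r ^ (n + m))"
    for \<gamma> :: "nat \<Rightarrow> complex" and m
  have tail_lim: "tail \<gamma> \<longlonglongrightarrow> 0"
    if "\<And>z. norm z < 1 \<Longrightarrow> (\<lambda>n. \<gamma> n * z ^ n) sums u z" for \<gamma> u
    unfolding tail_def by (rule suminf_exist_split2[OF abs_summable[OF that]])
  have partial: "norm (\<Sum>n<m. \<gamma> n * z ^ n) \<le> norm (u z) + tail \<gamma> m"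
    if S: "\<And>z. norm z < 1 \<Longrightarrow> (\<lambda>n. \<gamma> n * z ^ n) sums u z" and z: "norm z = r" for \<gamma> u m z
  proof -
    have sm: "summable (\<lambda>n. norm (\<gamma> n * z ^ n))"
      using abs_summable[OF S] z by (simp add: norm_mult norm_power)
    have "u z - (\<Sum>n<m. \<gamma> n * z ^ n) = (\<Sum>n. \<gamma> (n + m) * z ^ (n + m))"
      using S[of z] z r suminf_minus_initial_segment[of "\<lambda>n. \<gamma> n * z ^ n" m]
      by (simp add: sums_iff)
    also have "norm \<dots> \<le> (\<Sum>n. norm (\<gamma> (n + m) * z ^ (n + m)))"
      by (rule summable_norm) (rule summable_ignore_initial_segment[OF sm])
    also have "\<dots> = tail \<gamma> m"
      by (simp add: tail_def norm_mult norm_power z)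
    finally show ?thesis
      by (smt (verit) norm_minus_commute norm_triangle_ineq2)
  qed
  \<comment> \<open>The condition on \<open>m\<close> serves twice: the first \<open>N\<close> terms
    lie among those averaged, and \<open>m\<close> is positive, so the factor \<open>real m\<close>
    cancels.\<close>
  have bound: "(\<Sum>n<N. ((norm (\<alpha> n))\<^sup>2 + (norm (\<beta> n))\<^sup>2) * r ^ (2 * n))
      \<le> (K + tail \<alpha> m + tail \<beta> m)\<^sup>2" if m: "m \<ge> Suc N" for m
  proof -
    define w where "w j = cis (2 * pi * real j / real m)" for j
    have scaled: "(norm (\<gamma> n * of_real r ^ n))\<^sup>2 = (norm (\<gamma> n))\<^sup>2 * r ^ (2 * n)"
      for \<gamma> :: "nat \<Rightarrow> complex" and n
      using r by (simp add: norm_mult norm_power power_mult_distrib power_even_eq)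
    have terms: "(\<Sum>n<m. \<gamma> n * of_real r ^ n * w j ^ n) = (\<Sum>n<m. \<gamma> n * (of_real r * w j) ^ n)"
      for \<gamma> :: "nat \<Rightarrow> complex" and j
      by (simp add: power_mult_distrib mult_ac)
    have each: "(norm (\<Sum>n<m. \<alpha> n * (of_real r * w j) ^ n))\<^sup>2 +
        (norm (\<Sum>n<m. \<beta> n * (of_real r * w j) ^ n))\<^sup>2 \<le> (K + tail \<alpha> m + tail \<beta> m)\<^sup>2"
      (is "?x\<^sup>2 + ?y\<^sup>2 \<le> _") for j
    proof -
      have z: "norm (of_real r * w j) = r"
        using r by (simp add: norm_mult w_def)
      have "?x + ?y \<le> K + tail \<alpha> m + tail \<beta> m"
        using partial[OF \<phi> z, of m] partial[OF \<psi> z, of m] K[OF z] by simp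
      then have "(?x + ?y)\<^sup>2 \<le> (K + tail \<alpha> m + tail \<beta> m)\<^sup>2"
        by (intro power_mono) auto
      moreover have "?x\<^sup>2 + ?y\<^sup>2 \<le> (?x + ?y)\<^sup>2"
        by (simp add: power2_sum)
      ultimately show ?thesis
        by simp
    qed
    have "real m * (\<Sum>n<m. ((norm (\<alpha> n))\<^sup>2 + (norm (\<beta> n))\<^sup>2) * r ^ (2 * n)) =
        (\<Sum>j<m. (norm (\<Sum>n<m. \<alpha> n * (of_real r * w j) ^ n))\<^sup>2 +
          (norm (\<Sum>n<m. \<beta> n * (of_real r * w j) ^ n))\<^sup>2)"
      using parseval_roots_of_unity[where \<alpha> = "\<lambda>n. \<alpha> n * of_real r ^ n" and m = m]
        parseval_roots_of_unity[where \<alpha> = "\<lambda>n. \<beta> n * of_real r ^ n" and m = m]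
      unfolding scaled w_def[symmetric] terms
      by (simp add: sum.distrib distrib_left distrib_right)
    also have "\<dots> \<le> (\<Sum>j<m. (K + tail \<alpha> m + tail \<beta> m)\<^sup>2)"
      by (intro sum_mono each)
    finally have "(\<Sum>n<m. ((norm (\<alpha> n))\<^sup>2 + (norm (\<beta> n))\<^sup>2) * r ^ (2 * n))
        \<le> (K + tail \<alpha> m + tail \<beta> m)\<^sup>2"
      using m by simp
    moreover have "(\<Sum>n<N. ((norm (\<alpha> n))\<^sup>2 + (norm (\<beta> n))\<^sup>2) * r ^ (2 * n))
        \<le> (\<Sum>n<m. ((norm (\<alpha> n))\<^sup>2 + (norm (\<beta> n))\<^sup>2) * r ^ (2 * n))"
      using m r by (intro sum_mono2) auto
    ultimately show ?thesis
      by simp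
  qed
  \<comment> \<open>With \<open>N\<close> fixed, the number of roots of unity tends to infinity and
    both tail errors disappear.\<close>
  have "(\<lambda>m. (K + tail \<alpha> m + tail \<beta> m)\<^sup>2) \<longlonglongrightarrow> (K + 0 + 0)\<^sup>2"
    by (intro tendsto_intros tail_lim[OF \<phi>] tail_lim[OF \<psi>])
  from LIMSEQ_le_const[OF this] bound show ?thesis
    by auto
qed

section \<open>Where the constant \<open>M_const\<close> comes from\<close>

text \<open>For \<open>q \<ge> 1\<close> this is convexity of the power at the midpoint of
  \<open>x\<close> and \<open>y\<close>, which costs \<open>2 powr (q - 1)\<close>; for
  \<open>q < 1\<close> the power is subadditive and the constant is 1.\<close>

lemma powr_add_le_max:
  fixes x y q :: real
  assumes "0 \<le> x" "0 \<le> y" "0 < q"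
  shows "(x + y) powr q \<le> max (2 powr (q - 1)) 1 * (x powr q + y powr q)"
proof (cases "x = 0 \<or> y = 0")
  case True
  then show ?thesis
    using mult_right_mono[of 1 "max (2 powr (q - 1)) 1" "x powr q + y powr q"] assms by auto
next
  case False
  then have x: "0 < x" and y: "0 < y"
    using assms by auto
  show ?thesis
  proof (cases "q \<ge> 1")
    case True
    have convex: "((1 - 1/2) *\<^sub>R x + (1/2) *\<^sub>R y) powr q \<le> (1 - 1/2) * x powr q + 1/2 * y powr q"
      by (rule convex_onD[OF powr_convex[OF True]]) (use x y in auto)
    have mid: "((1 - 1/2) *\<^sub>R x + (1/2) *\<^sub>R y) powr q = (x + y) powr q / 2 powr q"
      using x y by (simp add: powr_divide flip: add_divide_distrib)
    have "(x + y) powr q / 2 powr q \<le> (x powr q + y powr q) / 2"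
      using convex unfolding mid by (simp add: add_divide_distrib)
    then have "(x + y) powr q \<le> 2 powr (q - 1) * (x powr q + y powr q)"
      by (simp add: powr_diff pos_divide_le_eq mult_ac)
    also have "\<dots> \<le> max (2 powr (q - 1)) 1 * (x powr q + y powr q)"
      by (intro mult_right_mono) auto
    finally show ?thesis .
  next
    case False
    \<comment> \<open>A number in (0, 1] does not decrease when raised to a power below 1. This is
      used for two fractions that add up to 1.\<close>
    have part: "t / (x + y) \<le> (t / (x + y)) powr q" if "0 < t" "t \<le> x + y" for t
      using powr_mono'[of q 1 "t / (x + y)"] that False by simp
    have "1 = x / (x + y) + y / (x + y)"
      using x y by (simp flip: add_divide_distrib)
    also have "\<dots> \<le> (x / (x + y)) powr q + (y / (x + y)) powr q"
      using part[of x] part[of y] x y by simp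
    also have "\<dots> = (x powr q + y powr q) / (x + y) powr q"
      using x y by (simp add: powr_divide add_divide_distrib)
    finally have "(x + y) powr q \<le> x powr q + y powr q"
      using x y by (simp add: pos_le_divide_eq)
    also have "\<dots> \<le> max (2 powr (q - 1)) 1 * (x powr q + y powr q)"
      using mult_right_mono[of 1 "max (2 powr (q - 1)) 1" "x powr q + y powr q"] by simp
    finally show ?thesis .
  qed
qed

text \<open>The preceding inequality with exponent \<open>2 / p\<close>, applied to the
  \<open>p\<close>-th powers of \<open>s\<close> and \<open>t\<close>.\<close>

lemma lp_norm_le_M_const:
  fixes s t p :: real
  assumes "0 \<le> s" "0 \<le> t" "p \<ge> 1"
  shows "((s powr p + t powr p) powr (1 / p))\<^sup>2 \<le> M_const p * (s\<^sup>2 + t\<^sup>2)"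
proof -
  have "((s powr p + t powr p) powr (1 / p))\<^sup>2 = (s powr p + t powr p) powr (2 / p)"
    by (simp add: power2_eq_square flip: powr_add)
  also have "\<dots> \<le> M_const p * ((s powr p) powr (2 / p) + (t powr p) powr (2 / p))"
    unfolding M_const_def using assms by (intro powr_add_le_max) auto
  also have "\<dots> = M_const p * (s\<^sup>2 + t\<^sup>2)"
    using assms by (simp add: powr_powr)
  finally show ?thesis .
qed

section \<open>The functions \<open>F_fun k\<close> as iterated integrals\<close>

text \<open>The integral of \<open>1 / (1 - t) ^ Suc k\<close> from 0 to \<open>x\<close>. It is the
  halfway stage to \<open>F_fun k\<close>, which is the integral of
  \<open>G_fun k t / t\<close>.\<close>

definition G_fun :: "nat \<Rightarrow> real \<Rightarrow> real" where
  "G_fun k x = (if k = 0 then - ln (1 - x) else (1 / (1 - x) ^ k - 1) / real k)"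

lemma G_fun_0 [simp]: "G_fun k 0 = 0"
  by (simp add: G_fun_def)

lemma F_fun_0 [simp]: "F_fun k 0 = 0"
  by (simp add: F_fun_def)

lemma has_derivative_inverse_power:
  fixes x :: real
  assumes "x < 1"
  shows "((\<lambda>x. 1 / (1 - x) ^ n - 1) has_real_derivative real n / (1 - x) ^ Suc n) (at x)"
proof -
  have "((\<lambda>x. 1 / (1 - x)) has_real_derivative (1 / (1 - x))\<^sup>2) (at x)"
    using assms by (auto intro!: derivative_eq_intros simp: power2_eq_square)
  from DERIV_diff[OF DERIV_power[OF this, of n] DERIV_const, of 1]
  have "((\<lambda>x. (1 / (1 - x)) ^ n - 1) has_real_derivative
      real n * ((1 / (1 - x))\<^sup>2 * (1 / (1 - x)) ^ (n - Suc 0))) (at x)"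
    by simp
  \<comment> \<open>The case split handles the truncated \<open>n - Suc 0\<close>: at
    \<open>n = 0\<close> both sides vanish through the factor \<open>real n\<close>.\<close>
  moreover have "real n * ((1 / (1 - x))\<^sup>2 * (1 / (1 - x)) ^ (n - Suc 0)) = real n / (1 - x) ^ Suc n"
    by (cases n) (auto simp: power2_eq_square power_one_over)
  ultimately have "((\<lambda>x. (1 / (1 - x)) ^ n - 1) has_real_derivative real n / (1 - x) ^ Suc n) (at x)"
    by (simp only:)
  then show ?thesis
    by (simp only: power_one_over)
qed

lemma G_fun_has_derivative:
  assumes "x < 1"
  shows "(G_fun k has_real_derivative 1 / (1 - x) ^ Suc k) (at x)"
proof (cases "k = 0")
  case True
  then have G: "G_fun k = (\<lambda>x. - ln (1 - x))"
    by (auto simp: G_fun_def)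
  show ?thesis
    unfolding G using True assms by (auto intro!: derivative_eq_intros)
next
  case False
  then have G: "G_fun k = (\<lambda>x. (1 / (1 - x) ^ k - 1) / real k)"
    by (auto simp: G_fun_def)
  show ?thesis
    unfolding G using DERIV_cdivide[OF has_derivative_inverse_power[OF assms, of k], of "real k"] False
    by simp
qed

text \<open>\<open>F_fun 0\<close> is the dilogarithm; termwise differentiation followed by
  multiplication by \<open>x\<close> leaves the logarithm series. The product form
  \<open>x * D\<close> avoids a division at \<open>x = 0\<close>.\<close>

lemma F_fun_0_has_derivative:
  assumes "0 \<le> x" "x < 1"
  shows "\<exists>D. (F_fun 0 has_real_derivative D) (at x) \<and> x * D = - ln (1 - x)"
proof -
  \<comment> \<open>Division by zero gives \<open>c 0 = 0\<close>, so the full power series agrees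
    with the one starting at index 1.\<close>
  define c where "c n = 1 / (real n)\<^sup>2" for n
  have sc: "summable (\<lambda>n. c n * z ^ n)" if "norm z < 1" for z :: real
  proof (rule summable_comparison_test)
    show "\<exists>N. \<forall>n\<ge>N. norm (c n * z ^ n) \<le> norm z ^ n"
    proof (intro exI allI impI)
      fix n :: nat assume "n \<ge> 1"
      then have "\<bar>c n\<bar> \<le> 1"
        by (simp add: c_def)
      then show "norm (c n * z ^ n) \<le> norm z ^ n"
        using mult_right_mono[of "\<bar>c n\<bar>" 1 "norm z ^ n"] by (simp add: abs_mult power_abs)
    qed
  qed (use that in \<open>simp add: summable_geometric\<close>)
  have F: "(\<Sum>n. c n * z ^ n) = F_fun 0 z" if "norm z < 1" for z
    using suminf_split_initial_segment[OF sc[OF that], of 1] by (simp add: F_fun_def c_def)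
  define D where "D = (\<Sum>n. diffs c n * x ^ n)"
  have "((\<lambda>z. \<Sum>n. c n * z ^ n) has_real_derivative D) (at x)"
    unfolding D_def by (rule termdiffs_strong'[where K = 1]) (use sc assms in auto)
  then have der: "(F_fun 0 has_real_derivative D) (at x)"
    by (rule has_field_derivative_transform_within_open[where S = "ball 0 1"]) (use F assms in auto)
  have dsum: "(\<lambda>n. diffs c n * x ^ n) sums D"
    unfolding D_def
    by (rule summable_sums, rule termdiff_converges[where K = 1]) (use sc assms in auto)
  have dc: "diffs c n = 1 / real (Suc n)" for n
    by (simp add: diffs_def c_def power2_eq_square del: of_nat_Suc)
  have "(\<lambda>n. x * (diffs c n * x ^ n)) sums (x * D)"
    by (rule sums_mult[OF dsum])
  then have "(\<lambda>n. x ^ Suc n / real (Suc n)) sums (x * D)"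
    by (simp add: dc mult_ac)
  then have "(\<lambda>n. x ^ n / real n) sums (x * D)"
    by (subst (asm) sums_Suc_iff) simp
  then have "(\<lambda>n. - (x ^ n / real n)) sums - (x * D)"
    by (rule sums_minus)
  moreover have "(\<lambda>n. - (x ^ n / real n)) sums ln (1 - x)"
    using ln_series'[of "-x"] assms by simp
  ultimately have "- (x * D) = ln (1 - x)"
    by (rule sums_unique2)
  then have "x * D = - ln (1 - x)"
    by simp
  then show ?thesis
    using der by blast
qed

lemma F_fun_has_derivative:
  assumes "0 \<le> x" "x < 1"
  shows "\<exists>D. (F_fun k has_real_derivative D) (at x) \<and> x * D = G_fun k x"
proof -
  have dln: "((\<lambda>x. ln (1 / (1 - x))) has_real_derivative 1 / (1 - x)) (at x)"
  proof -
    have "(\<lambda>x. ln (1 / (1 - x))) = (\<lambda>x::real. - ln (1 - x))"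
      by (simp add: divide_inverse ln_inverse)
    then show ?thesis
      using assms by (auto intro!: derivative_eq_intros)
  qed
  consider "k = 0" | "k = 1" | "k \<ge> 2"
    by linarith
  then show ?thesis
  proof cases
    case 1
    then show ?thesis
      using F_fun_0_has_derivative[OF assms] by (simp add: G_fun_def)
  next
    case 2
    then have F: "F_fun k = (\<lambda>x. ln (1 / (1 - x)))"
      by (auto simp: F_fun_def)
    show ?thesis
      unfolding F using dln 2 assms by (intro exI conjI) (auto simp: G_fun_def field_simps)
  next
    case 3
    then have F: "F_fun k = (\<lambda>x. 1 / real k * ln (1 / (1 - x)) +
        1 / real k * (\<Sum>n = 1..k - 1. 1 / real n * (1 / (1 - x) ^ n - 1)))"
      by (auto simp: F_fun_def)
    define y where "y = 1 / (1 - x)"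
    have y: "x * y = y - 1" "y \<noteq> 0"
      using assms by (auto simp: y_def field_simps)
    have "((\<lambda>x. \<Sum>n = 1..k - 1. 1 / real n * (1 / (1 - x) ^ n - 1)) has_real_derivative
        (\<Sum>n = 1..k - 1. 1 / real n * (real n / (1 - x) ^ Suc n))) (at x)"
      by (intro DERIV_sum DERIV_cmult has_derivative_inverse_power assms)
    also have "(\<Sum>n = 1..k - 1. 1 / real n * (real n / (1 - x) ^ Suc n)) = (\<Sum>n = 1..k - 1. y ^ Suc n)"
      by (intro sum.cong) (auto simp: y_def power_one_over)
    finally have der: "(F_fun k has_real_derivative 1 / real k * y +
        1 / real k * (\<Sum>n = 1..k - 1. y ^ Suc n)) (at x)"
      unfolding F y_def by (intro DERIV_add DERIV_cmult dln)
    \<comment> \<open>The derivative of the logarithm supplies the lowest power of \<open>y\<close>,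
      completing a geometric sum that \<open>x * y = y - 1\<close> then telescopes.\<close>
    have split: "y + (\<Sum>n = 1..k - 1. y ^ Suc n) = (\<Sum>n<k. y ^ Suc n)"
    proof -
      obtain j where j: "k = Suc j"
        using 3 by (cases k) auto
      have "(\<Sum>n<k. y ^ Suc n) = y + (\<Sum>n<j. y ^ Suc (Suc n))"
        unfolding j by (subst sum.lessThan_Suc_shift) simp
      also have "(\<Sum>n<j. y ^ Suc (Suc n)) = (\<Sum>n = 1..k - 1. y ^ Suc n)"
        unfolding j by (rule sum.reindex_bij_witness[of _ "\<lambda>n. n - 1" Suc]) auto
      finally show ?thesis
        by simp
    qed
    have "x * (\<Sum>n<k. y ^ Suc n) = (x * y) * (\<Sum>n<k. y ^ n)"
      by (simp add: sum_distrib_left mult_ac)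
    also have "\<dots> = y ^ k - 1"
      by (simp add: y power_diff_1_eq)
    finally have tele: "x * (y + (\<Sum>n = 1..k - 1. y ^ Suc n)) = y ^ k - 1"
      by (simp only: split)
    have "x * (1 / real k * y + 1 / real k * (\<Sum>n = 1..k - 1. y ^ Suc n)) =
        x * (y + (\<Sum>n = 1..k - 1. y ^ Suc n)) / real k"
      by (simp add: distrib_left add_divide_distrib)
    also have "\<dots> = G_fun k x"
      using 3 unfolding tele by (simp add: G_fun_def y_def power_one_over)
    finally show ?thesis
      using der by blast
  qed
qed

text \<open>
  Both \<open>F_fun k\<close> and the power sum are obtained from their majorants by integrating,
  dividing by the variable and integrating again, so the comparison is done on derivatives.
\<close>

lemma F_fun_comparison:
  fixes c :: "nat \<Rightarrow> real"
  assumes "0 \<le> K"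
    and le: "\<And>x. 0 \<le> x \<Longrightarrow> x < 1 \<Longrightarrow> (\<Sum>n<N. (real (Suc n))\<^sup>2 * c n * x ^ n) \<le> K / (1 - x) ^ Suc k"
    and xy: "0 \<le> x" "x \<le> y" "y < 1"
  shows "K * F_fun k x - (\<Sum>n<N. c n * x ^ Suc n) \<le> K * F_fun k y - (\<Sum>n<N. c n * y ^ Suc n)"
proof -
  define u where "u x = (\<Sum>n<N. c n * x ^ Suc n)" for x
  \<comment> \<open>\<open>v\<close> is the variable times the derivative of \<open>u\<close>, hence
    the counterpart of \<open>G_fun k\<close> on the side of the power sum.\<close>
  define v where "v x = (\<Sum>n<N. real (Suc n) * c n * x ^ Suc n)" for x
  have du: "(u has_real_derivative (\<Sum>n<N. real (Suc n) * c n * t ^ n)) (at t)" for t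
    unfolding u_def by (auto intro!: derivative_eq_intros sum.cong simp del: power_Suc)
  have dv: "(v has_real_derivative (\<Sum>n<N. (real (Suc n))\<^sup>2 * c n * t ^ n)) (at t)" for t
    unfolding v_def
    by (auto intro!: derivative_eq_intros sum.cong simp: power2_eq_square mult_ac simp del: power_Suc of_nat_Suc)
  have v_eq: "t * (\<Sum>n<N. real (Suc n) * c n * t ^ n) = v t" for t
    by (simp add: v_def sum_distrib_left mult_ac)
  have vG: "v t \<le> K * G_fun k t" if t: "0 \<le> t" "t < 1" for t
  proof -
    have "K * G_fun k 0 - v 0 \<le> K * G_fun k t - v t"
    proof (rule DERIV_nonneg_imp_nondecreasing[OF t(1)])
      fix s assume s: "0 \<le> s" "s \<le> t"
      have "((\<lambda>x. K * G_fun k x - v x) has_real_derivative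
          K * (1 / (1 - s) ^ Suc k) - (\<Sum>n<N. (real (Suc n))\<^sup>2 * c n * s ^ n)) (at s)"
        by (intro DERIV_diff DERIV_cmult G_fun_has_derivative dv) (use s t in auto)
      moreover have "0 \<le> K * (1 / (1 - s) ^ Suc k) - (\<Sum>n<N. (real (Suc n))\<^sup>2 * c n * s ^ n)"
        using le[of s] s t by simp
      ultimately show "\<exists>D. ((\<lambda>x. K * G_fun k x - v x) has_real_derivative D) (at s) \<and> 0 \<le> D"
        by blast
    qed
    then show ?thesis
      by (simp add: v_def)
  qed
  have cont: "continuous_on {x..y} (\<lambda>x. K * F_fun k x - u x)"
  proof (rule DERIV_atLeastAtMost_imp_continuous_on)
    fix t assume t: "x \<le> t" "t \<le> y"
    then obtain D where "(F_fun k has_real_derivative D) (at t)"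
      using F_fun_has_derivative[of t k] xy by auto
    then have "((\<lambda>x. K * F_fun k x - u x) has_real_derivative
        K * D - (\<Sum>n<N. real (Suc n) * c n * t ^ n)) (at t)"
      by (intro DERIV_diff DERIV_cmult du)
    then show "\<exists>D. ((\<lambda>x. K * F_fun k x - u x) has_real_derivative D) (at t)"
      by blast
  qed
  \<comment> \<open>Only interior points are examined: the sign of the derivative is read off after
    multiplication by \<open>t\<close>, which says nothing at \<open>t = 0\<close>.\<close>
  have "K * F_fun k x - u x \<le> K * F_fun k y - u y"
  proof (rule DERIV_nonneg_imp_increasing_open[OF xy(2) _ cont])
    fix t assume t: "x < t" "t < y"
    then obtain D where D: "(F_fun k has_real_derivative D) (at t)" "t * D = G_fun k t"
      using F_fun_has_derivative[of t k] xy by auto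
    have "((\<lambda>x. K * F_fun k x - u x) has_real_derivative
        K * D - (\<Sum>n<N. real (Suc n) * c n * t ^ n)) (at t)"
      by (intro DERIV_diff DERIV_cmult du D)
    moreover have "0 \<le> t * (K * D - (\<Sum>n<N. real (Suc n) * c n * t ^ n))"
      using vG[of t] v_eq[of t] D(2) t xy by (simp add: right_diff_distrib mult.left_commute)
    then have "0 \<le> K * D - (\<Sum>n<N. real (Suc n) * c n * t ^ n)"
      using t xy by (simp add: zero_le_mult_iff)
    ultimately show "\<exists>D. ((\<lambda>x. K * F_fun k x - u x) has_real_derivative D) (at t) \<and> 0 \<le> D"
      by blast
  qed
  then show ?thesis
    by (simp add: u_def)
qed

text \<open>The comparison with the single coefficient 1, whose majorant condition is
  \<open>1 \<le> 1 / (1 - t) ^ Suc k\<close>. It yields monotonicity of \<open>F_fun k\<close> and,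
  from \<open>x = 0\<close>, the lower bound \<open>y \<le> F_fun k y\<close>.\<close>

lemma F_fun_minus_id_mono:
  assumes "0 \<le> x" "x \<le> y" "y < 1"
  shows "F_fun k x - x \<le> F_fun k y - y"
proof -
  have "1 * F_fun k x - (\<Sum>n<1. 1 * x ^ Suc n) \<le> 1 * F_fun k y - (\<Sum>n<1. 1 * y ^ Suc n)"
  proof (rule F_fun_comparison[OF _ _ assms])
    fix t :: real assume "0 \<le> t" "t < 1"
    then show "(\<Sum>n<1. (real (Suc n))\<^sup>2 * 1 * t ^ n) \<le> 1 / (1 - t) ^ Suc k"
      using power_le_one[of "1 - t" "Suc k"] by (simp add: pos_le_divide_eq del: power_Suc)
  qed simp
  then show ?thesis
    by simp
qed

section \<open>Existence, uniqueness and use of the two radii\<close>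

lemma M_const_ge_1: "M_const p \<ge> 1"
  by (simp add: M_const_def)

text \<open>The left side of the equation decreases strictly on [0, 1] and changes sign there. This
  gives the unique root and also the inequality at every radius up to it, which is what the
  coefficient estimate uses.\<close>

lemma
  assumes "\<nu> > 0"
  shows ex1_is_r1: "\<exists>!r. is_r1 \<nu> p r"
    and is_r1_imp_le: "\<And>r s. is_r1 \<nu> p s \<Longrightarrow> 0 \<le> r \<Longrightarrow> r \<le> s \<Longrightarrow>
      M_const p * pi\<^sup>2 * r\<^sup>2 \<le> 6 * (1 - r\<^sup>2) powr (2 * \<nu>)"
proof -
  define \<Phi> where "\<Phi> r = 6 * (1 - r\<^sup>2) powr (2 * \<nu>) - M_const p * pi\<^sup>2 * r\<^sup>2" for r
  have root_iff: "is_r1 \<nu> p r \<longleftrightarrow> 0 < r \<and> r < 1 \<and> \<Phi> r = 0" for r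
    by (simp only: is_r1_def \<Phi>_def greaterThanLessThan_iff conj_assoc)
  have Mpi: "M_const p * pi\<^sup>2 > 0"
    using M_const_ge_1[of p] by simp
  have decr: "\<Phi> s < \<Phi> r" if "0 \<le> r" "r < s" "s \<le> 1" for r s
  proof -
    have sq: "r\<^sup>2 < s\<^sup>2" "s\<^sup>2 \<le> 1"
      using that by (auto intro: power_strict_mono power_le_one)
    have "(1 - s\<^sup>2) powr (2 * \<nu>) \<le> (1 - r\<^sup>2) powr (2 * \<nu>)"
      using sq assms by (intro powr_mono2) auto
    moreover have "M_const p * pi\<^sup>2 * r\<^sup>2 < M_const p * pi\<^sup>2 * s\<^sup>2"
      using sq Mpi by (intro mult_strict_left_mono) auto
    ultimately show ?thesis
      by (simp add: \<Phi>_def)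
  qed
  \<comment> \<open>The base vanishes at \<open>r = 1\<close>, where continuity of
    \<open>powr\<close> relies on the positive exponent \<open>2 * \<nu>\<close>.\<close>
  have cont: "continuous_on {0..1} \<Phi>"
    unfolding \<Phi>_def using assms
    by (intro continuous_intros continuous_on_powr') (auto simp: power_le_one)
  have ends: "\<Phi> 0 > 0" "\<Phi> 1 < 0"
    using Mpi by (auto simp: \<Phi>_def)
  have "\<exists>r\<ge>0. r \<le> 1 \<and> \<Phi> r = 0"
    by (rule IVT2') (use ends cont in auto)
  then obtain r where r: "0 \<le> r" "r \<le> 1" "\<Phi> r = 0"
    by blast
  have "r \<noteq> 0" "r \<noteq> 1"
    using r ends by auto
  with r have "is_r1 \<nu> p r"
    by (simp add: root_iff)
  moreover have "s = t" if "is_r1 \<nu> p s" "is_r1 \<nu> p t" for s t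
    using that decr[of s t] decr[of t s] unfolding root_iff by (cases s t rule: linorder_cases) auto
  ultimately show "\<exists>!r. is_r1 \<nu> p r"
    by blast
  show "M_const p * pi\<^sup>2 * r\<^sup>2 \<le> 6 * (1 - r\<^sup>2) powr (2 * \<nu>)"
    if "is_r1 \<nu> p s" "0 \<le> r" "r \<le> s" for r s
  proof -
    have "0 \<le> \<Phi> r"
      using that decr[of r s] unfolding root_iff by (cases "r = s") auto
    then show ?thesis
      by (simp add: \<Phi>_def)
  qed
qed

text \<open>Since \<open>F_fun k\<close> is nonnegative and nondecreasing, the left side increases
  strictly on [0, 1); the sign below the root is again the form needed later.\<close>

lemma
  shows ex1_is_r2: "\<exists>!r. is_r2 k p r"
    and is_r2_imp_le: "\<And>r s. is_r2 k p s \<Longrightarrow> 0 \<le> r \<Longrightarrow> r \<le> s \<Longrightarrow> M_const p * r * F_fun k r \<le> 1 - r"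
proof -
  define \<Phi> where "\<Phi> r = M_const p * r * F_fun k r - 1 + r" for r
  have root_iff: "is_r2 k p r \<longleftrightarrow> 0 < r \<and> r < 1 \<and> \<Phi> r = 0" for r
    by (simp only: is_r2_def \<Phi>_def greaterThanLessThan_iff conj_assoc)
  have incr: "\<Phi> r < \<Phi> s" if "0 \<le> r" "r < s" "s < 1" for r s
  proof -
    have F: "0 \<le> F_fun k r" "F_fun k r \<le> F_fun k s"
      using F_fun_minus_id_mono[of r s k] F_fun_minus_id_mono[of 0 r k] that by auto
    have "M_const p * r * F_fun k r \<le> M_const p * s * F_fun k s"
      using that F M_const_ge_1[of p] by (intro mult_mono) auto
    then show ?thesis
      using that by (simp add: \<Phi>_def)
  qed
  \<comment> \<open>The differentiability of \<open>F_fun k\<close> is available only below 1, so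
    the root is sought on a shorter interval. As \<open>F_fun k r \<ge> r\<close> and
    \<open>M_const p \<ge> 1\<close>, any right end with \<open>r^2 + r > 1\<close> works.\<close>
  have cont: "continuous_on {0..9/10} \<Phi>"
  proof -
    have "continuous_on {0..9/10} (F_fun k)"
    proof (rule DERIV_atLeastAtMost_imp_continuous_on)
      fix t :: real assume "0 \<le> t" "t \<le> 9/10"
      then show "\<exists>D. (F_fun k has_real_derivative D) (at t)"
        using F_fun_has_derivative[of t k] by auto
    qed
    then show ?thesis
      unfolding \<Phi>_def by (intro continuous_intros)
  qed
  have "\<Phi> 0 < 0"
    by (simp add: \<Phi>_def)
  moreover have "\<Phi> (9/10) > 0"
  proof -
    have "9/10 \<le> F_fun k (9/10)"
      using F_fun_minus_id_mono[of 0 "9/10" k] by simp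
    then have "1 * (9/10) * (9/10) \<le> M_const p * (9/10) * F_fun k (9/10)"
      using M_const_ge_1[of p] by (intro mult_mono) auto
    then show ?thesis
      by (simp add: \<Phi>_def)
  qed
  moreover have "\<exists>r\<ge>0. r \<le> 9/10 \<and> \<Phi> r = 0"
    by (rule IVT') (use calculation cont in auto)
  then obtain r where r: "0 \<le> r" "r \<le> 9/10" "\<Phi> r = 0"
    by blast
  ultimately have "r \<noteq> 0"
    by auto
  with r have "is_r2 k p r"
    by (simp add: root_iff)
  moreover have "s = t" if "is_r2 k p s" "is_r2 k p t" for s t
    using that incr[of s t] incr[of t s] unfolding root_iff by (cases s t rule: linorder_cases) auto
  ultimately show "\<exists>!r. is_r2 k p r"
    by blast
  show "M_const p * r * F_fun k r \<le> 1 - r" if "is_r2 k p s" "0 \<le> r" "r \<le> s" for r s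
  proof -
    have "\<Phi> r \<le> 0"
      using that incr[of r s] unfolding root_iff by (cases "r = s") auto
    then show ?thesis
      by (simp add: \<Phi>_def)
  qed
qed

section \<open>From the Bloch norm to coefficient bounds\<close>

text \<open>Membership bounds the weight of some decomposition. The Wirtinger derivatives of
  \<open>f\<close> determine \<open>deriv h\<close> and \<open>deriv g\<close> on the disk, so the
  bound passes to the given decomposition.\<close>

lemma bloch_weight_le:
  assumes f: "f \<in> harmonic_Bloch \<nu>" and dec: "canonical_decomposition f h g" and z: "z \<in> unit_disk"
  shows "bloch_weight \<nu> h g z \<le> bloch_seminorm \<nu> f"
proof -
  obtain h' g' where dec': "canonical_decomposition f h' g'"
    and bdd: "bdd_above (bloch_weight \<nu> h' g' ` unit_disk)"
    using f by (auto simp: harmonic_Bloch_def)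
  have "bloch_weight \<nu> h' g' w = bloch_weight \<nu> h g w" if "w \<in> unit_disk" for w
  proof -
    have "deriv h' w = deriv h w" "cnj (deriv g' w) = cnj (deriv g w)"
      using canonical_decomposition_wirtinger[OF dec' that]
        canonical_decomposition_wirtinger[OF dec that] by (auto simp del: complex_cnj_cancel_iff)
    then show ?thesis
      by (simp add: bloch_weight_def)
  qed
  then have "bloch_weight \<nu> h' g' ` unit_disk = bloch_weight \<nu> h g ` unit_disk"
    by (rule image_cong[OF refl])
  then show ?thesis
    unfolding bloch_seminorm_eq[OF dec] using bdd z by (intro cSUP_upper) simp_all
qed

text \<open>Parseval is applied to the derivatives of \<open>h\<close> and \<open>g\<close>; the
  weight factor is constant on the circle of radius \<open>r\<close> and can be divided out.\<close>

lemma bloch_coeff_squares_le: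
  fixes a b :: "nat \<Rightarrow> complex"
  assumes dec: "canonical_decomposition f h g"
    and h: "\<And>z. z \<in> unit_disk \<Longrightarrow> (\<lambda>n. a n * z ^ n) sums h z"
    and g: "\<And>z. z \<in> unit_disk \<Longrightarrow> (\<lambda>n. b (Suc n) * z ^ Suc n) sums g z"
    and K: "\<And>z. z \<in> unit_disk \<Longrightarrow> bloch_weight \<nu> h g z \<le> K"
    and r: "0 \<le> r" "r < 1"
  shows "(\<Sum>n<N. (real (Suc n))\<^sup>2 * ((norm (a (Suc n)))\<^sup>2 + (norm (b (Suc n)))\<^sup>2) * r ^ (2 * n))
    \<le> K\<^sup>2 / (1 - r\<^sup>2) powr (2 * \<nu>)"
proof -
  \<comment> \<open>The expansion of \<open>g\<close> leaves \<open>b 0\<close> arbitrary; resetting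
    it to 0 makes \<open>b'\<close> the full Taylor sequence of \<open>g\<close>.\<close>
  define b' where "b' = b(0 := 0)"
  have g': "(\<lambda>n. b' n * z ^ n) sums g z" if "z \<in> unit_disk" for z
  proof -
    have "(\<lambda>n. b' (Suc n) * z ^ Suc n) sums g z"
      using g[OF that] by (simp add: b'_def)
    then show ?thesis
      by (subst (asm) sums_Suc_iff) (simp add: b'_def)
  qed
  have der: "(u has_field_derivative deriv u z) (at z)"
    if "u holomorphic_on unit_disk" "norm z < 1" for u z
    using that by (auto intro!: holomorphic_derivI[where S = unit_disk])
  have hol: "h holomorphic_on unit_disk" "g holomorphic_on unit_disk"
    using dec by (auto simp: canonical_decomposition_def)
  have hd: "(\<lambda>n. diffs a n * z ^ n) sums deriv h z" if "norm z < 1" for z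
    by (rule termdiffs_sums_strong[OF _ der[OF hol(1) that] that]) (use h in simp)
  have gd: "(\<lambda>n. diffs b' n * z ^ n) sums deriv g z" if "norm z < 1" for z
    by (rule termdiffs_sums_strong[OF _ der[OF hol(2) that] that]) (use g' in simp)
  have r2: "r\<^sup>2 < 1"
    using r by (simp add: power_less_one_iff)
  have "(\<Sum>n<N. ((norm (diffs a n))\<^sup>2 + (norm (diffs b' n))\<^sup>2) * r ^ (2 * n))
      \<le> (K / (1 - r\<^sup>2) powr \<nu>)\<^sup>2"
  proof (rule sum_coeff_squares_le[OF hd gd r])
    fix z :: complex assume z: "norm z = r"
    then show "norm (deriv h z) + norm (deriv g z) \<le> K / (1 - r\<^sup>2) powr \<nu>"
      using K[of z] r r2 by (simp add: bloch_weight_def pos_le_divide_eq mult.commute)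
  qed
  also have "\<dots> = K\<^sup>2 / (1 - r\<^sup>2) powr (2 * \<nu>)"
    by (simp add: power2_eq_square flip: powr_add)
  also have "(\<Sum>n<N. ((norm (diffs a n))\<^sup>2 + (norm (diffs b' n))\<^sup>2) * r ^ (2 * n)) =
      (\<Sum>n<N. (real (Suc n))\<^sup>2 * ((norm (a (Suc n)))\<^sup>2 + (norm (b (Suc n)))\<^sup>2) * r ^ (2 * n))"
    by (simp add: diffs_def b'_def norm_mult power_mult_distrib distrib_left del: of_nat_Suc)
  finally show ?thesis .
qed

section \<open>The two Cauchy-Schwarz estimates\<close>

text \<open>The squared sum is at most \<open>K^2\<close> times a quotient that \<open>le\<close>
  bounds by 1. The partial sums of the Basel series produce the factor
  \<open>pi^2 / 6\<close>.\<close>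

lemma sum_le_if_le_r1:
  fixes A c :: "nat \<Rightarrow> real"
  assumes A: "\<And>n. (A n)\<^sup>2 \<le> M_const p * c n"
    and c: "(\<Sum>n<N. (real (Suc n))\<^sup>2 * c n * r ^ (2 * n)) \<le> K\<^sup>2 / (1 - r\<^sup>2) powr (2 * \<nu>)"
    and r: "0 \<le> r" "r < 1" and "0 \<le> K"
    and le: "M_const p * pi\<^sup>2 * r\<^sup>2 \<le> 6 * (1 - r\<^sup>2) powr (2 * \<nu>)"
  shows "(\<Sum>n<N. A n * r ^ Suc n) \<le> K"
proof (rule power2_le_imp_le[OF _ \<open>0 \<le> K\<close>])
  define P where "P = (1 - r\<^sup>2) powr (2 * \<nu>)"
  have P: "P > 0"
    using r by (simp add: P_def power_less_one_iff less_imp_neq)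
  have basel: "(\<Sum>n<N. (r / real (Suc n))\<^sup>2) \<le> r\<^sup>2 * (pi\<^sup>2 / 6)"
  proof -
    have "(\<Sum>n<N. 1 / (real n + 1)\<^sup>2) \<le> pi\<^sup>2 / 6"
      using sum_le_suminf[of "\<lambda>n. 1 / (real n + 1)\<^sup>2" "{..<N}"] inverse_squares_sums
      by (simp add: sums_iff add.commute)
    then have "r\<^sup>2 * (\<Sum>n<N. 1 / (real n + 1)\<^sup>2) \<le> r\<^sup>2 * (pi\<^sup>2 / 6)"
      by (rule mult_left_mono) simp
    then show ?thesis
      by (simp add: power_divide sum_distrib_left add.commute)
  qed
  have "(\<Sum>n<N. A n * r ^ Suc n) = (\<Sum>n<N. real (Suc n) * A n * r ^ n * (r / real (Suc n)))"
    by (intro sum.cong) (auto simp del: of_nat_Suc)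
  also have "\<dots>\<^sup>2 \<le> (\<Sum>n<N. (real (Suc n) * A n * r ^ n)\<^sup>2) * (\<Sum>n<N. (r / real (Suc n))\<^sup>2)"
    by (rule Cauchy_Schwarz_ineq_sum)
  also have "\<dots> \<le> (M_const p * (K\<^sup>2 / P)) * (r\<^sup>2 * (pi\<^sup>2 / 6))"
  proof (rule mult_mono[OF _ basel])
    have "(\<Sum>n<N. (real (Suc n) * A n * r ^ n)\<^sup>2) \<le>
        (\<Sum>n<N. M_const p * ((real (Suc n))\<^sup>2 * c n * r ^ (2 * n)))"
    proof (rule sum_mono)
      fix n
      have "(real (Suc n) * A n * r ^ n)\<^sup>2 = ((real (Suc n))\<^sup>2 * r ^ (2 * n)) * (A n)\<^sup>2"
        by (simp add: power_mult_distrib power_even_eq del: of_nat_Suc)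
      also have "\<dots> \<le> ((real (Suc n))\<^sup>2 * r ^ (2 * n)) * (M_const p * c n)"
        using r by (intro mult_left_mono A) auto
      finally show "(real (Suc n) * A n * r ^ n)\<^sup>2 \<le> M_const p * ((real (Suc n))\<^sup>2 * c n * r ^ (2 * n))"
        by (simp only: mult_ac)
    qed
    also have "\<dots> \<le> M_const p * (K\<^sup>2 / P)"
      unfolding sum_distrib_left[symmetric] P_def
      using M_const_ge_1[of p] by (intro mult_left_mono c) auto
    finally show "(\<Sum>n<N. (real (Suc n) * A n * r ^ n)\<^sup>2) \<le> M_const p * (K\<^sup>2 / P)" .
  qed (use P M_const_ge_1[of p] in \<open>auto intro!: sum_nonneg\<close>)
  also have "\<dots> = K\<^sup>2 * ((M_const p * pi\<^sup>2 * r\<^sup>2) / (6 * P))"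
    by (simp add: mult_ac)
  also have "\<dots> \<le> K\<^sup>2 * 1"
    using le P by (intro mult_left_mono) (auto simp: P_def)
  finally show "(\<Sum>n<N. A n * r ^ Suc n)\<^sup>2 \<le> K\<^sup>2"
    by simp
qed

text \<open>The majorant is assumed on all of [0, 1), not just at one radius, because the comparison
  integrates it from 0 up to \<open>r\<close>.\<close>

lemma sum_le_if_le_r2:
  fixes A c :: "nat \<Rightarrow> real"
  assumes A: "\<And>n. (A n)\<^sup>2 \<le> M_const p * c n"
    and c: "\<And>x. 0 \<le> x \<Longrightarrow> x < 1 \<Longrightarrow> (\<Sum>n<N. (real (Suc n))\<^sup>2 * c n * x ^ n) \<le> K\<^sup>2 / (1 - x) ^ Suc k"
    and r: "0 \<le> r" "r < 1" and "0 \<le> K"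
    and le: "M_const p * r * F_fun k r \<le> 1 - r"
  shows "(\<Sum>n<N. A n * r ^ Suc n) \<le> K"
proof (rule power2_le_imp_le[OF _ \<open>0 \<le> K\<close>])
  \<comment> \<open>The comparison starts at 0, where both functions vanish.\<close>
  have F: "(\<Sum>n<N. c n * r ^ Suc n) \<le> K\<^sup>2 * F_fun k r"
    using F_fun_comparison[OF zero_le_power2 c, of 0 r] r by simp
  have F_nonneg: "0 \<le> F_fun k r"
    using F_fun_minus_id_mono[of 0 r k] r by simp
  have geom: "(\<Sum>n<N. (sqrt (r ^ Suc n))\<^sup>2) \<le> r / (1 - r)"
  proof -
    have "(\<Sum>n<N. (sqrt (r ^ Suc n))\<^sup>2) = r * (\<Sum>n<N. r ^ n)"
      using r by (simp add: sum_distrib_left)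
    also have "\<dots> \<le> r * (1 / (1 - r))"
      using r by (intro mult_left_mono) (auto simp: sum_gp_strict divide_right_mono)
    finally show ?thesis
      by simp
  qed
  \<comment> \<open>Half of each power of \<open>r\<close> stays with the coefficient, the other
    half forms the geometric series.\<close>
  have "(\<Sum>n<N. A n * r ^ Suc n) = (\<Sum>n<N. A n * sqrt (r ^ Suc n) * sqrt (r ^ Suc n))"
    using r by (simp only: mult.assoc real_sqrt_mult_self abs_of_nonneg zero_le_power)
  also have "\<dots>\<^sup>2 \<le> (\<Sum>n<N. (A n * sqrt (r ^ Suc n))\<^sup>2) * (\<Sum>n<N. (sqrt (r ^ Suc n))\<^sup>2)"
    by (rule Cauchy_Schwarz_ineq_sum)
  also have "\<dots> \<le> (M_const p * (K\<^sup>2 * F_fun k r)) * (r / (1 - r))"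
  proof (rule mult_mono[OF _ geom])
    have "(\<Sum>n<N. (A n * sqrt (r ^ Suc n))\<^sup>2) \<le> (\<Sum>n<N. M_const p * (c n * r ^ Suc n))"
    proof (rule sum_mono)
      fix n
      have "(A n * sqrt (r ^ Suc n))\<^sup>2 = (A n)\<^sup>2 * r ^ Suc n"
        using r by (simp add: power_mult_distrib del: power_Suc)
      also have "\<dots> \<le> M_const p * c n * r ^ Suc n"
        using r by (intro mult_right_mono A) auto
      finally show "(A n * sqrt (r ^ Suc n))\<^sup>2 \<le> M_const p * (c n * r ^ Suc n)"
        by (simp only: mult_ac)
    qed
    also have "\<dots> \<le> M_const p * (K\<^sup>2 * F_fun k r)"
      unfolding sum_distrib_left[symmetric]
      using M_const_ge_1[of p] by (intro mult_left_mono F) auto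
    finally show "(\<Sum>n<N. (A n * sqrt (r ^ Suc n))\<^sup>2) \<le> M_const p * (K\<^sup>2 * F_fun k r)" .
  qed (use F_nonneg M_const_ge_1[of p] in \<open>auto intro!: sum_nonneg\<close>)
  also have "\<dots> = K\<^sup>2 * ((M_const p * r * F_fun k r) / (1 - r))"
    by simp
  also have "\<dots> \<le> K\<^sup>2 * 1"
    using le r by (intro mult_left_mono) auto
  finally show "(\<Sum>n<N. A n * r ^ Suc n)\<^sup>2 \<le> K\<^sup>2"
    by simp
qed

section \<open>Assembling the estimates\<close>

theorem theorem7:
  fixes \<nu> p :: real and k :: nat
    and f h g :: "complex \<Rightarrow> complex" and a b :: "nat \<Rightarrow> complex"
  assumes "\<nu> > 0"
    and "\<nu> \<in> {real k / 2 <.. (real k + 1) / 2}"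
    and "p \<ge> 1"
    and "f \<in> harmonic_Bloch \<nu>"
    and "canonical_decomposition f h g"
    and "\<And>z. z \<in> unit_disk \<Longrightarrow> (\<lambda>n. a n * z ^ n) sums h z"
    and "\<And>z. z \<in> unit_disk \<Longrightarrow> (\<lambda>n. b (Suc n) * z ^ Suc n) sums g z"
    and "bloch_norm \<nu> f \<le> 1"
  shows "(\<exists>!r. is_r1 \<nu> p r) \<and> (\<exists>!r. is_r2 k p r) \<and>
    (\<forall>(z::complex) r. norm z = r \<and> r \<le> max (r1 \<nu> p) (r2 k p) \<longrightarrow>
       summable (\<lambda>n. (norm (a (Suc n)) powr p + norm (b (Suc n)) powr p) powr (1 / p) * r ^ Suc n) \<and>
       norm (a 0) +
         (\<Sum>n. (norm (a (Suc n)) powr p + norm (b (Suc n)) powr p) powr (1 / p) * r ^ Suc n) \<le> 1)"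
proof (intro conjI allI impI)
  show ex_r1: "\<exists>!r. is_r1 \<nu> p r"
    by (rule ex1_is_r1[OF assms(1)])
  show ex_r2: "\<exists>!r. is_r2 k p r"
    by (rule ex1_is_r2)
  have r1: "is_r1 \<nu> p (r1 \<nu> p)"
    unfolding r1_def by (rule theI'[OF ex_r1])
  have r2: "is_r2 k p (r2 k p)"
    unfolding r2_def by (rule theI'[OF ex_r2])
  define A where "A n = (norm (a (Suc n)) powr p + norm (b (Suc n)) powr p) powr (1 / p)" for n
  define c where "c n = (norm (a (Suc n)))\<^sup>2 + (norm (b (Suc n)))\<^sup>2" for n
  define K where "K = 1 - norm (a 0)"
  have Ac: "(A n)\<^sup>2 \<le> M_const p * c n" for n
    unfolding A_def c_def using assms(3) by (intro lp_norm_le_M_const) auto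
  have "h 0 = a 0"
    using assms(6)[of 0] powser_sums_zero[of a] by (simp add: sums_iff)
  then have "f 0 = a 0"
    using assms(5) by (auto simp: canonical_decomposition_def)
  then have weight: "bloch_weight \<nu> h g z \<le> K" if "z \<in> unit_disk" for z
    using bloch_weight_le[OF assms(4,5) that] assms(8) by (simp add: K_def bloch_norm_def)
  have "0 \<le> bloch_weight \<nu> h g 0"
    by (simp add: bloch_weight_def)
  also have "\<dots> \<le> K"
    by (rule weight) simp
  finally have K: "0 \<le> K" .
  have coeff: "(\<Sum>n<N. (real (Suc n))\<^sup>2 * c n * r ^ (2 * n)) \<le> K\<^sup>2 / (1 - r\<^sup>2) powr (2 * \<nu>)"
    if "0 \<le> r" "r < 1" for r N
    unfolding c_def by (rule bloch_coeff_squares_le[OF assms(5-7) weight that])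
  have coeff': "(\<Sum>n<N. (real (Suc n))\<^sup>2 * c n * x ^ n) \<le> K\<^sup>2 / (1 - x) ^ Suc k"
    if x: "0 \<le> x" "x < 1" for x N
  proof -
    \<comment> \<open>Parseval at radius \<open>sqrt x\<close>; the exponent is then raised from
      \<open>2 * \<nu>\<close> to \<open>k + 1\<close>, which can only lower a power of
      \<open>1 - x\<close>.\<close>
    have "(\<Sum>n<N. (real (Suc n))\<^sup>2 * c n * x ^ n) \<le> K\<^sup>2 / (1 - x) powr (2 * \<nu>)"
      using coeff[of "sqrt x" N] x by (simp add: power_mult)
    also have "\<dots> \<le> K\<^sup>2 / (1 - x) powr real (Suc k)"
      using x assms(2) by (intro divide_left_mono powr_mono') auto
    also have "\<dots> = K\<^sup>2 / (1 - x) ^ Suc k"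
      using x by (simp only: powr_realpow)
    finally show ?thesis .
  qed
  fix z :: complex and r :: real
  assume "norm z = r \<and> r \<le> max (r1 \<nu> p) (r2 k p)"
  then have r0: "0 \<le> r" and r: "r \<le> r1 \<nu> p \<or> r \<le> r2 k p"
    by auto
  then have r_lt: "r < 1"
    using r1 r2 by (auto simp: is_r1_def is_r2_def)
  \<comment> \<open>A bound uniform in \<open>N\<close> on nonnegative terms gives both the
    convergence of the series and the bound on its sum.\<close>
  have partial: "(\<Sum>n<N. A n * r ^ Suc n) \<le> K" for N
    using r
  proof
    assume "r \<le> r1 \<nu> p"
    then show ?thesis
      by (intro sum_le_if_le_r1[OF Ac coeff[OF r0 r_lt] r0 r_lt K] is_r1_imp_le[OF assms(1) r1 r0])
  next
    assume "r \<le> r2 k p"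
    then show ?thesis
      by (intro sum_le_if_le_r2[OF Ac coeff' r0 r_lt K] is_r2_imp_le[OF r2 r0])
  qed
  have summable: "summable (\<lambda>n. A n * r ^ Suc n)"
    by (rule summableI_nonneg_bounded[OF _ partial]) (use r0 in \<open>simp add: A_def\<close>)
  then show "summable (\<lambda>n. (norm (a (Suc n)) powr p + norm (b (Suc n)) powr p) powr (1 / p) * r ^ Suc n)"
    by (simp only: A_def)
  have "(\<Sum>n. A n * r ^ Suc n) \<le> K"
    by (rule suminf_le_const[OF summable partial])
  then show "norm (a 0) +
      (\<Sum>n. (norm (a (Suc n)) powr p + norm (b (Suc n)) powr p) powr (1 / p) * r ^ Suc n) \<le> 1"
    by (simp only: A_def K_def)
qed

end
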